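(* For every $n\in\mathbb{N}$ there exists an operator $t_n$ on $\ell_2$ such that $t_n\in ext(\ell_2,Z_2)$ and $\|t_n\|\leq 1$, but any extension to $Z_2$ of a compact perturbation of $t_n$ has norm at least $n$.
   Context: The scalar field is either $\mathbb{R}$ or $\mathbb{C}$. The Kalton--Peck space $Z_2$ is the twisted sum $\ell_2\oplus_{\Omega}\ell_2$, where $\Omega=\Omega_2$ is the quasi-linear map given on finitely supported vectors by $\Omega(x)(n)=x(n)\log\frac{\|x\|_2}{|x(n)|}$ (with value $0$ where $x(n)=0$); i.e. $Z_2$ is the space of pairs $(x,y)$ of sequences with $y\in\ell_2$, $x-\Omega y\in\ell_2$, with quasi-norm $\|(x,y)\|=\|x-\Omega y\|_2+\|y\|_2$ (equivalent to a Banach space norm). The space $\ell_2$ is identified with the subspace $\{(x,0):x\in\ell_2\}$ of $Z_2$, so an operator on $\ell_2$ is also regarded as an element of $L(\ell_2,Z_2)$. $ext(\ell_2,Z_2)$ is the set of $t\in L(\ell_2,Z_2)$ admitting an extension $T\in L(Z_2)$, i.e. $T_{|\ell_2}=t$. A compact perturbation of $t_n$ is an operator $t_n+k$ with $k\in L(\ell_2,Z_2)$ compact; an extension of it to $Z_2$ is an operator $T\in L(Z_2)$ with $T_{|\ell_2}=t_n+k$. *)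

theory Defs
  imports "HOL-Analysis.Analysis" "HOL-Library.Function_Algebras"
begin

text \<open>
  A quasi-normed space over \<open>'k\<close> is given as a linear subspace \<open>points\<close> of an ambient additive
  group (addition is that of the type), a scalar multiplication and a quasi-norm. Operators are
  total functions of which only the values on \<open>points\<close> matter.
\<close>

record ('k, 'v) qn_space =
  points :: "'v set"
  scale :: "'k \<Rightarrow> 'v \<Rightarrow> 'v"
  qnorm :: "'v \<Rightarrow> real"

definition operators ::
    "('k, 'v::ab_group_add) qn_space \<Rightarrow> ('k, 'w::ab_group_add) qn_space \<Rightarrow> ('v \<Rightarrow> 'w) set" where
  "operators X Y = {f.
     (\<forall>x\<in>points X. f x \<in> points Y) \<and>
     (\<forall>x\<in>points X. \<forall>y\<in>points X. f (x + y) = f x + f y) \<and>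
     (\<forall>c. \<forall>x\<in>points X. f (scale X c x) = scale Y c (f x)) \<and>
     (\<exists>C. \<forall>x\<in>points X. qnorm Y (f x) \<le> C * qnorm X x)}"

definition op_norm :: "('k, 'v) qn_space \<Rightarrow> ('k, 'w) qn_space \<Rightarrow> ('v \<Rightarrow> 'w) \<Rightarrow> real" where
  "op_norm X Y f = (SUP x\<in>{x \<in> points X. qnorm X x \<le> 1}. qnorm Y (f x))"

text \<open>
  Compactness is stated sequentially, since a quasi-norm need not induce a metric: every sequence
  in the unit ball has a subsequence whose image converges in the target space.
\<close>

definition compact_operators ::
    "('k, 'v::ab_group_add) qn_space \<Rightarrow> ('k, 'w::ab_group_add) qn_space \<Rightarrow> ('v \<Rightarrow> 'w) set" where
  "compact_operators X Y = {f \<in> operators X Y.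
     \<forall>s::nat \<Rightarrow> 'v. (\<forall>j. s j \<in> points X \<and> qnorm X (s j) \<le> 1) \<longrightarrow>
       (\<exists>r y. strict_mono r \<and> y \<in> points Y \<and>
          (\<lambda>j. qnorm Y (f (s (r j)) - y)) \<longlonglongrightarrow> 0)}"

definition l2_norm :: "(nat \<Rightarrow> 'a::real_normed_field) \<Rightarrow> real" where
  "l2_norm x = sqrt (\<Sum>n. (norm (x n))\<^sup>2)"

definition ell2 :: "('a::real_normed_field, nat \<Rightarrow> 'a) qn_space" where
  "ell2 = \<lparr> points = {x. summable (\<lambda>n. (norm (x n))\<^sup>2)},
            scale = (\<lambda>c x n. c * x n),
            qnorm = l2_norm \<rparr>"

text \<open>
  The formula for the Kalton--Peck map makes sense on all of \<open>\<ell>\<^sub>2\<close>, with values in the space of all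
  sequences; this is what the description of \<open>Z\<^sub>2\<close> as a space of pairs of sequences uses.
\<close>

definition Kalton_Peck_map :: "(nat \<Rightarrow> 'a::real_normed_field) \<Rightarrow> nat \<Rightarrow> 'a" where
  "Kalton_Peck_map x n =
     (if x n = 0 then 0 else x n * of_real (ln (l2_norm x / norm (x n))))"

definition Z2 :: "('a::real_normed_field, (nat \<Rightarrow> 'a) \<times> (nat \<Rightarrow> 'a)) qn_space" where
  "Z2 = \<lparr> points = {(x, y). y \<in> points ell2 \<and> x - Kalton_Peck_map y \<in> points ell2},
          scale = (\<lambda>c (x, y). (scale ell2 c x, scale ell2 c y)),
          qnorm = (\<lambda>(x, y). l2_norm (x - Kalton_Peck_map y) + l2_norm y) \<rparr>"

definition ell2_in_Z2 :: "(nat \<Rightarrow> 'a::real_normed_field) \<Rightarrow> (nat \<Rightarrow> 'a) \<times> (nat \<Rightarrow> 'a)" where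
  "ell2_in_Z2 x = (x, 0)"

lemma ell2_in_Z2_isometric:
  shows "ell2_in_Z2 x \<in> points Z2 \<longleftrightarrow> x \<in> points ell2"
    and "qnorm Z2 (ell2_in_Z2 x) = qnorm ell2 x"
proof -
  have "Kalton_Peck_map 0 = (0 :: nat \<Rightarrow> 'a)"
    by (simp add: Kalton_Peck_map_def fun_eq_iff)
  then show "ell2_in_Z2 x \<in> points Z2 \<longleftrightarrow> x \<in> points ell2"
    and "qnorm Z2 (ell2_in_Z2 x) = qnorm ell2 x"
    by (simp_all add: Z2_def ell2_def ell2_in_Z2_def l2_norm_def)
qed

definition extensions ::
    "((nat \<Rightarrow> 'a::real_normed_field) \<Rightarrow> (nat \<Rightarrow> 'a) \<times> (nat \<Rightarrow> 'a)) \<Rightarrow>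
     ((nat \<Rightarrow> 'a) \<times> (nat \<Rightarrow> 'a) \<Rightarrow> (nat \<Rightarrow> 'a) \<times> (nat \<Rightarrow> 'a)) set" where
  "extensions t = {T \<in> operators Z2 Z2. \<forall>x\<in>points ell2. T (ell2_in_Z2 x) = t x}"

definition ext :: "((nat \<Rightarrow> 'a::real_normed_field) \<Rightarrow> (nat \<Rightarrow> 'a) \<times> (nat \<Rightarrow> 'a)) set" where
  "ext = {t \<in> operators ell2 Z2. extensions t \<noteq> {}}"

end

theory Submission imports Defs begin

text \<open>
  Left multiplication by the quaternion \<open>(-1 + i + j + k) / 2\<close> is an orthogonal \<open>4 \<times> 4\<close> matrix \<open>Q\<close>
  with all entries \<open>\<plusminus> 1 / 2\<close> and \<open>Q\<^sup>2 = Q\<^sup>T\<close>, hence its tensor power \<open>H\<close> of order \<open>k\<close> is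
  orthogonal of size \<open>m = 4 ^ k\<close>, and \<open>H\<close> and \<open>H\<^sup>2 = H\<^sup>T\<close> are flat. The operator \<open>t\<close> is the direct
  sum of infinitely many copies of \<open>H\<close>; being an isometry on finite blocks it commutes with the
  Kalton--Peck map up to a bounded error, so \<open>(x, y) \<mapsto> (t x, t y)\<close> extends it.

  Let \<open>L = ln (2 ^ k)\<close>. For a flat functional \<open>h\<close> of a block, \<open>(x, y) \<mapsto> \<langle>x - L y, h\<rangle>\<close> is bounded by
  \<open>2\<close> on \<open>Z\<^sub>2\<close>, since \<open>\<Omega> y\<close> pairs with \<open>h\<close> like \<open>L y\<close>. Both \<open>(0, e\<^sub>j)\<close> and \<open>(L H e\<^sub>j, H e\<^sub>j)\<close> have norm
  \<open>1\<close>. Apply \<open>T\<close>, pair the former with \<open>H e\<^sub>j\<close> and the latter with \<open>H\<^sup>2 e\<^sub>j\<close>, and sum over the block: the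
  contributions of \<open>T (0, \<cdot>)\<close> are the same trace, while \<open>T (L H e\<^sub>j, 0)\<close> contributes \<open>L m\<close> up to the
  compact perturbation, which tends to \<open>0\<close> as the block moves to infinity. So \<open>L\<close> is at most a
  constant times the norm of \<open>T\<close>.
\<close>

section \<open>The spaces \<open>\<ell>\<^sub>2\<close> and \<open>Z\<^sub>2\<close>\<close>

lemma mult_abs_ln_le:
  fixes s :: real
  assumes "s > 0"
  shows "s * \<bar>ln s\<bar> \<le> 1 + s\<^sup>2"
proof (cases "s \<ge> 1")
  case True
  then have "s * \<bar>ln s\<bar> \<le> s * s"
    using ln_le_minus_one[of s] by (intro mult_left_mono) auto
  then show ?thesis by (simp add: power2_eq_square)
next
  case False
  have "- ln s \<le> 1 / s"
    using ln_le_minus_one[of "1 / s"] assms by (simp add: ln_div)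
  then have "s * - ln s \<le> s * (1 / s)"
    using assms by (intro mult_left_mono) auto
  moreover have "\<bar>ln s\<bar> = - ln s"
    using False assms by simp
  ultimately have "s * \<bar>ln s\<bar> \<le> 1"
    using assms by simp
  then show ?thesis by (smt (verit) zero_le_power2)
qed

lemma mult_ln_divide_le:
  fixes s \<rho> :: real
  assumes "0 < s" "s \<le> \<rho>"
  shows "\<bar>s * ln (\<rho> / s)\<bar> \<le> \<rho>"
proof -
  have "0 \<le> ln (\<rho> / s)" using assms by simp
  moreover have "ln (\<rho> / s) \<le> \<rho> / s"
    using ln_le_minus_one[of "\<rho> / s"] assms by simp
  ultimately have "0 \<le> s * ln (\<rho> / s)" "s * ln (\<rho> / s) \<le> s * (\<rho> / s)"
    using assms by (simp, intro mult_left_mono) auto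
  then show ?thesis using assms by simp
qed

text \<open>Unlike the preceding bound by \<open>\<rho>\<close>, this one vanishes as
  \<open>s\<close> tends to 0, which gives the decay of the coordinates of \<Omega>. It comes from
  \<open>ln u \<le> u\<close> at \<open>u = sqrt (\<rho> / s)\<close>.\<close>

lemma mult_ln_divide_le_sqrt:
  fixes s \<rho> :: real
  assumes "0 < s" "s \<le> \<rho>"
  shows "\<bar>s * ln (\<rho> / s)\<bar> \<le> 2 * sqrt (\<rho> * s)"
proof -
  have "0 \<le> ln (\<rho> / s)" using assms by simp
  moreover have "ln (\<rho> / s) \<le> 2 * sqrt (\<rho> / s)"
    using ln_le_minus_one[of "sqrt (\<rho> / s)"] assms by (simp add: ln_sqrt)
  ultimately have "0 \<le> s * ln (\<rho> / s)" "s * ln (\<rho> / s) \<le> s * (2 * sqrt (\<rho> / s))"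
    using assms by (auto intro: mult_left_mono simp del: real_sqrt_divide)
  moreover have "s * (2 * sqrt (\<rho> / s)) = 2 * sqrt (\<rho> * s)"
    using assms by (simp add: real_sqrt_divide real_sqrt_mult field_simps)
  ultimately show ?thesis by simp
qed

section \<open>Norm and membership in the sequence space\<close>

lemma points_ell2 [simp]: "x \<in> points ell2 \<longleftrightarrow> summable (\<lambda>n. (norm (x n))\<^sup>2)"
  by (simp add: ell2_def)

lemma scale_ell2 [simp]: "scale ell2 c x = (\<lambda>n. c * x n)"
  by (simp add: ell2_def)

lemma qnorm_ell2 [simp]: "qnorm ell2 = l2_norm"
  by (simp add: ell2_def)

lemma l2_norm_nonneg: "x \<in> points ell2 \<Longrightarrow> 0 \<le> l2_norm x"
  by (simp add: l2_norm_def suminf_nonneg)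

lemma L2_set_le_l2_norm:
  assumes "x \<in> points ell2" "finite A"
  shows "L2_set (\<lambda>n. norm (x n)) A \<le> l2_norm x"
  using assms unfolding L2_set_def l2_norm_def
  by (auto intro!: sum_le_suminf)

lemma norm_le_l2_norm: "x \<in> points ell2 \<Longrightarrow> norm (x i) \<le> l2_norm x"
  using L2_set_le_l2_norm[of x "{i}"] by simp

lemma l2_boundI:
  assumes "\<And>n. L2_set (\<lambda>i. norm (x i)) {..<n} \<le> C"
  shows "x \<in> points ell2" and "l2_norm x \<le> C"
proof -
  have C: "0 \<le> C" using assms[of 0] by simp
  have *: "(\<Sum>i<n. (norm (x i))\<^sup>2) \<le> C\<^sup>2" for n
    using power_mono[OF assms[of n], of 2] by (simp add: L2_set_def sum_nonneg)
  show "x \<in> points ell2"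
    using bounded_imp_summable[of "\<lambda>i. (norm (x i))\<^sup>2" "C\<^sup>2"] *[of "Suc _"]
    by (simp add: lessThan_Suc_atMost)
  then have "(\<Sum>i. (norm (x i))\<^sup>2) \<le> C\<^sup>2"
    using * by (intro suminf_le_const) auto
  then show "l2_norm x \<le> C"
    unfolding l2_norm_def using C by (simp add: real_le_lsqrt)
qed

lemma
  fixes x y :: "nat \<Rightarrow> 'a::real_normed_field"
  assumes "x \<in> points ell2" "y \<in> points ell2"
  shows add_in_ell2: "x + y \<in> points ell2"
    and l2_norm_triangle: "l2_norm (x + y) \<le> l2_norm x + l2_norm y"
proof -
  have *: "L2_set (\<lambda>i. norm ((x + y) i)) {..<n} \<le> l2_norm x + l2_norm y" for n
  proof -
    have "L2_set (\<lambda>i. norm ((x + y) i)) {..<n} \<le> L2_set (\<lambda>i. norm (x i) + norm (y i)) {..<n}"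
      by (intro L2_set_mono) (auto intro: norm_triangle_ineq)
    also have "\<dots> \<le> L2_set (\<lambda>i. norm (x i)) {..<n} + L2_set (\<lambda>i. norm (y i)) {..<n}"
      by (rule L2_set_triangle_ineq)
    also have "\<dots> \<le> l2_norm x + l2_norm y"
      using assms by (intro add_mono L2_set_le_l2_norm) auto
    finally show ?thesis .
  qed
  show "x + y \<in> points ell2" "l2_norm (x + y) \<le> l2_norm x + l2_norm y"
    using l2_boundI[of "x + y", OF *] by auto
qed

lemma scale_in_ell2:
  fixes x :: "nat \<Rightarrow> 'a::real_normed_field"
  shows "x \<in> points ell2 \<Longrightarrow> (\<lambda>n. c * x n) \<in> points ell2"
  by (simp add: norm_mult power_mult_distrib summable_mult)

lemma l2_dominated:
  assumes "x \<in> points ell2" "\<And>n. norm (y n) \<le> norm (x n)"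
  shows "y \<in> points ell2"
  unfolding points_ell2
proof (rule summable_comparison_test)
  show "\<exists>N. \<forall>n\<ge>N. norm ((norm (y n))\<^sup>2) \<le> (norm (x n))\<^sup>2"
    using assms(2) by (auto intro!: power_mono)
qed (use assms(1) in simp)

lemma l2_finite_support:
  assumes "finite A" "\<And>i. i \<notin> A \<Longrightarrow> x i = 0"
  shows "x \<in> points ell2" "l2_norm x = L2_set (\<lambda>i. norm (x i)) A"
  using sums_finite[OF assms(1), of "\<lambda>n. (norm (x n))\<^sup>2"] assms(2)
  by (auto simp: l2_norm_def L2_set_def sums_iff)

section \<open>Quasi-additivity of the Kalton-Peck map\<close>

lemma Kalton_Peck_map_0 [simp]: "Kalton_Peck_map 0 = 0"
  by (simp add: Kalton_Peck_map_def fun_eq_iff)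

lemma l2_norm_0 [simp]: "l2_norm 0 = 0"
  by (simp add: l2_norm_def)

lemma points_Z2: "(x, y) \<in> points Z2 \<longleftrightarrow> y \<in> points ell2 \<and> x - Kalton_Peck_map y \<in> points ell2"
  by (simp add: Z2_def)

lemma scale_Z2 [simp]: "scale Z2 c (x, y) = (\<lambda>n. c * x n, \<lambda>n. c * y n)"
  by (simp add: Z2_def)

lemma qnorm_Z2: "qnorm Z2 (x, y) = l2_norm (x - Kalton_Peck_map y) + l2_norm y"
  by (simp add: Z2_def)

lemma norm_mult_ln_diff_le:
  fixes u :: "'a::real_normed_field"
  assumes "norm u \<le> s"
  shows "norm (u * of_real (ln s) - u * of_real (ln (norm u))) \<le> s"
proof (cases "u = 0")
  case True
  then show ?thesis using assms by simp
next
  case False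
  then have "s > 0" using assms by (meson less_le_trans zero_less_norm_iff)
  have "u * of_real (ln s) - u * of_real (ln (norm u)) = u * of_real (ln (s / norm u))"
    using False \<open>s > 0\<close> by (simp add: ln_div algebra_simps)
  then show ?thesis
    using mult_ln_divide_le[of "norm u" s] False assms by (simp add: norm_mult abs_mult)
qed

text \<open>The logarithms are taken relative to \<open>norm a + norm b\<close>, whose own logarithm cancels by
  linearity.\<close>

lemma quasi_additive_mult_ln:
  fixes a b :: "'a::real_normed_field"
  shows "norm (a * of_real (ln (norm a)) + b * of_real (ln (norm b))
           - (a + b) * of_real (ln (norm (a + b)))) \<le> 3 * (norm a + norm b)"
proof -
  define s where "s = norm a + norm b"
  define \<phi> where "\<phi> = (\<lambda>u::'a. u * of_real (ln s) - u * of_real (ln (norm u)))"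
  have *: "norm (\<phi> u) \<le> s" if "norm u \<le> s" for u
    unfolding \<phi>_def using that by (rule norm_mult_ln_diff_le)
  have "a * of_real (ln (norm a)) + b * of_real (ln (norm b))
           - (a + b) * of_real (ln (norm (a + b))) = \<phi> (a + b) - (\<phi> a + \<phi> b)"
    by (simp add: \<phi>_def algebra_simps)
  also have "norm \<dots> \<le> norm (\<phi> (a + b)) + (norm (\<phi> a) + norm (\<phi> b))"
    by (meson norm_triangle_ineq norm_triangle_ineq4 order_trans add_mono order_refl)
  also have "\<dots> \<le> s + (s + s)"
    by (intro add_mono *) (auto simp: s_def norm_triangle_ineq)
  finally show ?thesis by (simp add: s_def)
qed

text \<open>Splitting the logarithm isolates the only non-local part of \<Omega>, a scalar multiple
  of \<open>x\<close>. The value of \<open>ln 0\<close> is harmless at zero coordinates, being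
  multiplied by 0.\<close>

lemma Kalton_Peck_map_eq:
  fixes x :: "nat \<Rightarrow> 'a::real_normed_field"
  assumes "x \<in> points ell2"
  shows "Kalton_Peck_map x n = x n * of_real (ln (l2_norm x)) - x n * of_real (ln (norm (x n)))"
proof (cases "x n = 0")
  case False
  then have "l2_norm x > 0" using norm_le_l2_norm[OF assms, of n] by (meson less_le_trans zero_less_norm_iff)
  then show ?thesis using False by (simp add: Kalton_Peck_map_def ln_div algebra_simps)
qed (simp add: Kalton_Peck_map_def)

text \<open>The non-local parts contribute multiples of \<open>x\<close> and \<open>y\<close>; the
  coordinatewise rest is dominated through \<open>quasi_additive_mult_ln\<close>. Membership is all
  that \<open>diff_in_Z2\<close> asks for.\<close>

lemma Kalton_Peck_map_quasi_additive:
  fixes x y :: "nat \<Rightarrow> 'a::real_normed_field"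
  assumes x: "x \<in> points ell2" and y: "y \<in> points ell2"
  shows "Kalton_Peck_map x + Kalton_Peck_map y - Kalton_Peck_map (x + y) \<in> points ell2"
proof -
  let ?c = "\<lambda>x::nat \<Rightarrow> 'a. of_real (ln (l2_norm x)) :: 'a"
  let ?\<psi> = "\<lambda>n. x n * of_real (ln (norm (x n))) + y n * of_real (ln (norm (y n)))
           - (x n + y n) * of_real (ln (norm (x n + y n)))"
  have xy: "x + y \<in> points ell2" using x y by (rule add_in_ell2)
  have eq: "Kalton_Peck_map x + Kalton_Peck_map y - Kalton_Peck_map (x + y)
      = (\<lambda>n. (?c x - ?c (x + y)) * x n) + (\<lambda>n. (?c y - ?c (x + y)) * y n) + (\<lambda>n. - 1 * ?\<psi> n)"
    using x y xy by (simp add: fun_eq_iff Kalton_Peck_map_eq algebra_simps del: points_ell2)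
  have "(\<lambda>n. 3 * of_real (norm (x n)) :: 'a) + (\<lambda>n. 3 * of_real (norm (y n))) \<in> points ell2"
    by (rule add_in_ell2; rule scale_in_ell2) (use x y in simp_all)
  then have "?\<psi> \<in> points ell2"
  proof (rule l2_dominated)
    fix n
    have "norm (((\<lambda>n. 3 * of_real (norm (x n)) :: 'a) + (\<lambda>n. 3 * of_real (norm (y n)))) n)
        = norm (of_real (3 * (norm (x n) + norm (y n))) :: 'a)"
      by (simp add: algebra_simps)
    also have "\<dots> = 3 * (norm (x n) + norm (y n))"
      unfolding norm_of_real by simp
    finally show "norm (?\<psi> n) \<le> norm (((\<lambda>n. 3 * of_real (norm (x n)) :: 'a) + (\<lambda>n. 3 * of_real (norm (y n)))) n)"
      using quasi_additive_mult_ln[of "x n" "y n"] by simp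
  qed
  then show ?thesis
    unfolding eq using x y by (intro add_in_ell2 scale_in_ell2)
qed

lemma diff_in_Z2:
  fixes z w :: "(nat \<Rightarrow> 'a::real_normed_field) \<times> (nat \<Rightarrow> 'a)"
  assumes "z \<in> points Z2" "w \<in> points Z2"
  shows "z - w \<in> points Z2"
proof -
  obtain x y where z: "z = (x, y)" by fastforce
  obtain u v where w: "w = (u, v)" by fastforce
  have y: "y \<in> points ell2" and x: "x - Kalton_Peck_map y \<in> points ell2"
    and v: "v \<in> points ell2" and u: "u - Kalton_Peck_map v \<in> points ell2"
    using assms by (auto simp: z w points_Z2)
  have yv: "y - v \<in> points ell2"
    using add_in_ell2[OF y scale_in_ell2[OF v, of "-1"]]
    by (simp add: plus_fun_def fun_diff_def)
  \<comment> \<open>Quasi-additivity is applied to \<open>y - v\<close> and \<open>v\<close>, whose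
    sum is \<open>y\<close>.\<close>
  have eq: "x - u - Kalton_Peck_map (y - v) = (x - Kalton_Peck_map y)
      + (\<lambda>n. - 1 * (u - Kalton_Peck_map v) n)
      + (\<lambda>n. - 1 * (Kalton_Peck_map (y - v) + Kalton_Peck_map v - Kalton_Peck_map (y - v + v)) n)"
    by (simp add: fun_eq_iff)
  have "x - u - Kalton_Peck_map (y - v) \<in> points ell2"
    unfolding eq by (intro add_in_ell2 scale_in_ell2 x u Kalton_Peck_map_quasi_additive yv v)
  with yv show ?thesis by (simp add: z w points_Z2)
qed

section \<open>A block diagonal Hadamard operator\<close>

text \<open>The matrix of left multiplication by \<open>(-1 + i + j + k) / 2\<close> in the basis \<open>1, i, j, k\<close>.\<close>

definition quaternion_matrix :: "nat \<Rightarrow> nat \<Rightarrow> real" where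
  "quaternion_matrix i j =
     (if (i, j) \<in> {(1, 0), (2, 0), (3, 0), (1, 3), (2, 1), (3, 2)} then 1 / 2 else - 1 / 2)"

text \<open>Each recursion step splits off the last base 4 digit of both indices, as in a Kronecker
  product. The indices are unbounded and the base case compares the remaining quotients, so this is
  already the infinite block diagonal matrix.\<close>

fun hadamard :: "nat \<Rightarrow> nat \<Rightarrow> nat \<Rightarrow> real" where
  "hadamard 0 i j = of_bool (i = j)"
| "hadamard (Suc k) i j = quaternion_matrix (i mod 4) (j mod 4) * hadamard k (i div 4) (j div 4)"

definition block :: "nat \<Rightarrow> nat \<Rightarrow> nat set" where
  "block k r = {r * 4 ^ k..<r * 4 ^ k + 4 ^ k}"

lemma finite_block [simp]: "finite (block k r)"
  and card_block [simp]: "card (block k r) = 4 ^ k"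
  by (simp_all add: block_def)

lemma mem_block: "i \<in> block k r \<longleftrightarrow> i div 4 ^ k = r"
proof
  assume "i \<in> block k r"
  then show "i div 4 ^ k = r"
    by (intro div_nat_eqI) (auto simp: block_def mult.commute)
qed (auto simp: block_def add.commute intro: div_times_less_eq_dividend dividend_less_div_times)

lemma abs_hadamard: "\<bar>hadamard k i j\<bar> = (if i div 4 ^ k = j div 4 ^ k then 1 / 2 ^ k else 0)"
  by (induction k arbitrary: i j)
     (auto simp: abs_mult quaternion_matrix_def div_mult2_eq)

lemma hadamard_eq_0: "i div 4 ^ k \<noteq> j div 4 ^ k \<Longrightarrow> hadamard k i j = 0"
  using abs_hadamard[of k i j] by simp

lemma sum_interval_4:
  fixes f :: "nat \<Rightarrow> 'a::comm_monoid_add"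
  shows "sum f {4 * a..<4 * a + 4 * n} = (\<Sum>i\<in>{a..<a + n}. \<Sum>d<4. f (4 * i + d))"
proof (induction n)
  case (Suc n)
  have "sum f {4 * a..<4 * a + 4 * Suc n}
      = sum f {4 * a..<4 * a + 4 * n} + sum f {4 * a + 4 * n..<4 * a + 4 * Suc n}"
    by (intro sum.atLeastLessThan_concat[symmetric]) auto
  also have "sum f {4 * a + 4 * n..<4 * a + 4 * Suc n} = (\<Sum>d<4. f (4 * (a + n) + d))"
    by (subst sum.atLeastLessThan_shift_0) (simp add: atLeast0LessThan algebra_simps)
  finally show ?case
    using Suc.IH by simp
qed simp

text \<open>Splitting off the last digit produces the double sums that factor along the recursion of
  \<open>hadamard\<close>.\<close>

lemma sum_block_Suc:
  fixes f :: "nat \<Rightarrow> 'a::comm_monoid_add"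
  shows "sum f (block (Suc k) r) = (\<Sum>i\<in>block k r. \<Sum>d<4. f (4 * i + d))"
  using sum_interval_4[of f "r * 4 ^ k" "4 ^ k"] by (simp add: block_def mult.left_commute)

lemma lt_4_cases: "d < 4 \<Longrightarrow> d = 0 \<or> d = 1 \<or> d = 2 \<or> d = (3::nat)"
  by auto

text \<open>The quaternion q has norm 1 and real part -1/2, so q^2 + q + 1 = 0 and q^2 is the
  conjugate of q; conjugation transposes the matrix. The proof checks all sixteen entries.\<close>

lemma
  assumes "a < 4" "b < 4"
  shows quaternion_orthogonal_columns:
      "(\<Sum>d<4. quaternion_matrix d a * quaternion_matrix d b) = of_bool (a = b)"
    and quaternion_orthogonal_rows:
      "(\<Sum>d<4. quaternion_matrix a d * quaternion_matrix b d) = of_bool (a = b)"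
    and quaternion_square:
      "(\<Sum>d<4. quaternion_matrix a d * quaternion_matrix d b) = quaternion_matrix b a"
  using lt_4_cases[OF assms(1)] lt_4_cases[OF assms(2)]
  by (auto simp: quaternion_matrix_def eval_nat_numeral)

lemma mod_div_eq_iff: "a mod n = b mod n \<and> a div n = b div n \<longleftrightarrow> a = (b::nat)"
  by (metis div_mod_decomp)

text \<open>The summand is a factor in the last digit times a factor in the other digits, so the 4 x
  4 identity tensors up. Columns yield the isometry; rows, treated next, normalise the
  pairings.\<close>

lemma hadamard_orthogonal_columns:
  "(\<Sum>i\<in>block k r. hadamard k i j * hadamard k i l) = of_bool (j = l \<and> j \<in> block k r)"
proof (induction k arbitrary: j l)
  case 0
  then show ?case by (auto simp: block_def)
next
  case (Suc k)
  have "(\<Sum>i\<in>block (Suc k) r. hadamard (Suc k) i j * hadamard (Suc k) i l)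
      = (\<Sum>i\<in>block k r. \<Sum>d<4. (hadamard k i (j div 4) * hadamard k i (l div 4)) *
           (quaternion_matrix d (j mod 4) * quaternion_matrix d (l mod 4)))"
    unfolding sum_block_Suc by (intro sum.cong refl) (simp add: mult_ac)
  also have "\<dots> = of_bool (j div 4 = l div 4 \<and> j div 4 \<in> block k r) * of_bool (j mod 4 = l mod 4)"
    by (simp add: sum_distrib_left[symmetric] sum_distrib_right[symmetric] Suc
        quaternion_orthogonal_columns)
  also have "\<dots> = of_bool (j = l \<and> j \<in> block (Suc k) r)"
    using mod_div_eq_iff[of j 4 l] by (auto simp: mem_block div_mult2_eq)
  finally show ?case .
qed

lemma hadamard_orthogonal_rows:
  "(\<Sum>i\<in>block k r. hadamard k j i * hadamard k l i) = of_bool (j = l \<and> j \<in> block k r)"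
proof (induction k arbitrary: j l)
  case 0
  then show ?case by (auto simp: block_def)
next
  case (Suc k)
  have "(\<Sum>i\<in>block (Suc k) r. hadamard (Suc k) j i * hadamard (Suc k) l i)
      = (\<Sum>i\<in>block k r. \<Sum>d<4. (hadamard k (j div 4) i * hadamard k (l div 4) i) *
           (quaternion_matrix (j mod 4) d * quaternion_matrix (l mod 4) d))"
    unfolding sum_block_Suc by (intro sum.cong refl) (simp add: mult_ac)
  also have "\<dots> = of_bool (j div 4 = l div 4 \<and> j div 4 \<in> block k r) * of_bool (j mod 4 = l mod 4)"
    by (simp add: sum_distrib_left[symmetric] sum_distrib_right[symmetric] Suc
        quaternion_orthogonal_rows)
  also have "\<dots> = of_bool (j = l \<and> j \<in> block (Suc k) r)"
    using mod_div_eq_iff[of j 4 l] by (auto simp: mem_block div_mult2_eq)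
  finally show ?case .
qed

text \<open>Used twice later: \<open>hadamard_op k\<close> maps a column to a row, hence to a flat
  vector again, and the two traces agree.\<close>

lemma hadamard_square:
  "j \<in> block k r \<Longrightarrow> (\<Sum>i\<in>block k r. hadamard k j i * hadamard k i l) = hadamard k l j"
proof (induction k arbitrary: j l)
  case 0
  then show ?case by (auto simp: block_def)
next
  case (Suc k)
  have j: "j div 4 \<in> block k r"
    using Suc.prems by (simp add: mem_block div_mult2_eq)
  have "(\<Sum>i\<in>block (Suc k) r. hadamard (Suc k) j i * hadamard (Suc k) i l)
      = (\<Sum>i\<in>block k r. \<Sum>d<4. (hadamard k (j div 4) i * hadamard k i (l div 4)) *
           (quaternion_matrix (j mod 4) d * quaternion_matrix d (l mod 4)))"
    unfolding sum_block_Suc by (intro sum.cong refl) (simp add: mult_ac)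
  also have "\<dots> = hadamard (Suc k) l j"
    by (simp add: sum_distrib_left[symmetric] sum_distrib_right[symmetric] Suc.IH[OF j]
        quaternion_square)
  finally show ?case .
qed

text \<open>The real inner product structure makes the real matrices \<open>hadamard k\<close> isometric on
  real and complex sequences alike.\<close>

definition hadamard_op :: "nat \<Rightarrow> (nat \<Rightarrow> 'a::real_vector) \<Rightarrow> nat \<Rightarrow> 'a" where
  "hadamard_op k x i = (\<Sum>j\<in>block k (i div 4 ^ k). hadamard k i j *\<^sub>R x j)"

lemma hadamard_op_block:
  "i \<in> block k r \<Longrightarrow> hadamard_op k x i = (\<Sum>j\<in>block k r. hadamard k i j *\<^sub>R x j)"
  by (simp add: hadamard_op_def mem_block)

lemma hadamard_op_add: "hadamard_op k (x + y) = hadamard_op k x + hadamard_op k y"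
  by (simp add: hadamard_op_def fun_eq_iff scaleR_add_right sum.distrib)

lemma hadamard_op_diff: "hadamard_op k (x - y) = hadamard_op k x - hadamard_op k y"
  by (simp add: hadamard_op_def fun_eq_iff scaleR_diff_right sum_subtractf)

lemma hadamard_op_scale:
  fixes x :: "nat \<Rightarrow> 'a::real_normed_field"
  shows "hadamard_op k (\<lambda>n. c * x n) = (\<lambda>n. c * hadamard_op k x n)"
  by (simp add: hadamard_op_def fun_eq_iff sum_distrib_left)

lemma hadamard_op_isometric_block:
  fixes x :: "nat \<Rightarrow> 'a::real_inner"
  shows "(\<Sum>i\<in>block k r. (norm (hadamard_op k x i))\<^sup>2) = (\<Sum>i\<in>block k r. (norm (x i))\<^sup>2)"
proof -
  let ?B = "block k r"
  have "(\<Sum>i\<in>?B. (norm (hadamard_op k x i))\<^sup>2)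
      = (\<Sum>i\<in>?B. \<Sum>j\<in>?B. \<Sum>l\<in>?B. (hadamard k i j * hadamard k i l) * (x j \<bullet> x l))"
    by (intro sum.cong refl)
       (simp add: power2_norm_eq_inner hadamard_op_block inner_sum_left inner_sum_right
         sum_distrib_left inner_commute mult_ac)
  also have "\<dots> = (\<Sum>j\<in>?B. \<Sum>i\<in>?B. \<Sum>l\<in>?B. (hadamard k i j * hadamard k i l) * (x j \<bullet> x l))"
    by (rule sum.swap)
  also have "\<dots> = (\<Sum>j\<in>?B. \<Sum>l\<in>?B. (\<Sum>i\<in>?B. hadamard k i j * hadamard k i l) * (x j \<bullet> x l))"
    unfolding sum_distrib_right by (rule sum.cong[OF refl]) (rule sum.swap)
  also have "\<dots> = (\<Sum>j\<in>?B. (norm (x j))\<^sup>2)"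
    by (simp add: hadamard_orthogonal_columns power2_norm_eq_inner of_bool_def
        if_distrib[where f = "\<lambda>u. u * _"] cong: if_cong)
  finally show ?thesis .
qed

text \<open>The blocks partition the naturals, so an estimate with one \<open>C\<close> for all
  blocks survives summation.\<close>

lemma l2_le_of_blocks:
  assumes x: "x \<in> points ell2" and C: "0 \<le> C"
    and le: "\<And>r. (\<Sum>i\<in>block k r. (norm (y i))\<^sup>2) \<le> C\<^sup>2 * (\<Sum>i\<in>block k r. (norm (x i))\<^sup>2)"
  shows "y \<in> points ell2" and "l2_norm y \<le> C * l2_norm x"
proof -
  have "L2_set (\<lambda>i. norm (y i)) {..<n} \<le> C * l2_norm x" for n
  proof -
    \<comment> \<open>Rounding up to a multiple of \<open>4 ^ k\<close> makes the segment a union of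
      whole blocks.\<close>
    have "(\<Sum>i<n. (norm (y i))\<^sup>2) \<le> (\<Sum>i<n * 4 ^ k. (norm (y i))\<^sup>2)"
      by (intro sum_mono2) auto
    also have "\<dots> = (\<Sum>r<n. \<Sum>i\<in>block k r. (norm (y i))\<^sup>2)"
      unfolding block_def by (rule sum.nat_group[symmetric])
    also have "\<dots> \<le> (\<Sum>r<n. C\<^sup>2 * (\<Sum>i\<in>block k r. (norm (x i))\<^sup>2))"
      by (intro sum_mono le)
    also have "\<dots> = C\<^sup>2 * (\<Sum>i<n * 4 ^ k. (norm (x i))\<^sup>2)"
      unfolding block_def sum_distrib_left[symmetric] by (subst sum.nat_group) simp
    finally have "L2_set (\<lambda>i. norm (y i)) {..<n} \<le> C * L2_set (\<lambda>i. norm (x i)) {..<n * 4 ^ k}"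
      using C real_sqrt_le_mono by (fastforce simp: L2_set_def real_sqrt_mult)
    also have "\<dots> \<le> C * l2_norm x"
      using x C by (intro mult_left_mono L2_set_le_l2_norm) auto
    finally show ?thesis .
  qed
  then show "y \<in> points ell2" "l2_norm y \<le> C * l2_norm x"
    using l2_boundI by blast+
qed

lemma
  fixes x :: "nat \<Rightarrow> 'a::{real_normed_field, real_inner}"
  assumes x: "x \<in> points ell2"
  shows hadamard_op_in_ell2: "hadamard_op k x \<in> points ell2"
    and l2_norm_hadamard_op: "l2_norm (hadamard_op k x) = l2_norm x"
proof -
  note le = l2_le_of_blocks[where C = 1 and k = k]
  show H: "hadamard_op k x \<in> points ell2"
    by (rule le(1)[OF x]) (simp_all add: hadamard_op_isometric_block)
  show "l2_norm (hadamard_op k x) = l2_norm x"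
    \<comment> \<open>Equality on blocks lets the estimate run in both directions.\<close>
    using le(2)[OF x, of "hadamard_op k x"] le(2)[OF H, of x]
    by (simp add: hadamard_op_isometric_block)
qed

text \<open>On a block the Kalton--Peck map can be normalised by the \<open>\<ell>\<^sub>1\<close>-norm of the block
  instead: this changes it by a scalar multiple of the identity, which commutes with
  the operator.\<close>

lemma norm_hadamard_op_commutator_le:
  fixes y :: "nat \<Rightarrow> 'a::{real_normed_field, real_inner}"
  assumes y: "y \<in> points ell2" and i: "i \<in> block k r"
  shows "norm (hadamard_op k (Kalton_Peck_map y) i - Kalton_Peck_map (hadamard_op k y) i)
    \<le> (4 ^ k + 1) * (\<Sum>j\<in>block k r. norm (y j))"
proof -
  let ?B = "block k r" and ?h = "hadamard k i" and ?w = "hadamard_op k y i"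
  define s where "s = (\<Sum>j\<in>?B. norm (y j))"
  define \<phi> where "\<phi> = (\<lambda>u::'a. u * of_real (ln s) - u * of_real (ln (norm u)))"
  have \<phi>: "norm (\<phi> u) \<le> s" if "norm u \<le> s" for u
    unfolding \<phi>_def using that by (rule norm_mult_ln_diff_le)
  have h: "\<bar>?h j\<bar> \<le> 1" for j
    by (simp add: abs_hadamard)
  have w: "?w = (\<Sum>j\<in>?B. ?h j *\<^sub>R y j)"
    using i by (rule hadamard_op_block)
  have y_le: "norm (y j) \<le> s" if "j \<in> ?B" for j
    unfolding s_def using that by (intro member_le_sum) auto
  have w_le: "norm ?w \<le> s"
    unfolding w s_def using h by (intro sum_norm_le) (simp add: mult_left_le_one_le)
  let ?c = "of_real (ln (l2_norm y)) - of_real (ln s) :: 'a"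
  have "hadamard_op k (Kalton_Peck_map y) i
      = (\<Sum>j\<in>?B. ?h j *\<^sub>R \<phi> (y j) + ?h j *\<^sub>R y j * ?c)"
    unfolding hadamard_op_block[OF i]
    by (intro sum.cong refl)
       (simp add: Kalton_Peck_map_eq[OF y] \<phi>_def algebra_simps)
  also have "\<dots> = (\<Sum>j\<in>?B. ?h j *\<^sub>R \<phi> (y j)) + ?w * ?c"
    unfolding w sum_distrib_right by (rule sum.distrib)
  \<comment> \<open>The two l2 norms inside \<Omega> agree by isometry, so the \<open>?c\<close>
    terms cancel.\<close>
  finally have "hadamard_op k (Kalton_Peck_map y) i - Kalton_Peck_map (hadamard_op k y) i
      = (\<Sum>j\<in>?B. ?h j *\<^sub>R \<phi> (y j)) - \<phi> ?w"
    by (simp add: Kalton_Peck_map_eq[OF hadamard_op_in_ell2[OF y]] l2_norm_hadamard_op[OF y]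
        \<phi>_def algebra_simps)
  also have "norm \<dots> \<le> norm (\<Sum>j\<in>?B. ?h j *\<^sub>R \<phi> (y j)) + norm (\<phi> ?w)"
    by (rule norm_triangle_ineq4)
  also have "\<dots> \<le> (\<Sum>j\<in>?B. s) + s"
    using h \<phi>[OF w_le] \<phi>[OF y_le]
    by (intro add_mono sum_norm_le) (auto intro: order_trans[OF mult_left_le_one_le])
  finally show ?thesis by (simp add: s_def algebra_simps)
qed

text \<open>Besides the coordinatewise factor \<open>4 ^ k + 1\<close>, a factor
  \<open>2 ^ k\<close> comes from Cauchy-Schwarz (l1 against l2 on a block) and another from adding
  \<open>4 ^ k\<close> squares. The growth in \<open>k\<close> is harmless: an extension only has to
  exist.\<close>

lemma
  fixes y :: "nat \<Rightarrow> 'a::{real_normed_field, real_inner}" and k :: nat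
  assumes y: "y \<in> points ell2"
  defines "z \<equiv> hadamard_op k (Kalton_Peck_map y) - Kalton_Peck_map (hadamard_op k y)"
  shows hadamard_op_commutator_in_ell2: "z \<in> points ell2"
    and l2_norm_hadamard_op_commutator_le: "l2_norm z \<le> (4 ^ k + 1) * 4 ^ k * l2_norm y"
proof -
  have le: "(\<Sum>i\<in>block k r. (norm (z i))\<^sup>2)
      \<le> ((4 ^ k + 1) * 4 ^ k)\<^sup>2 * (\<Sum>i\<in>block k r. (norm (y i))\<^sup>2)" for r
  proof -
    let ?B = "block k r"
    have "(\<Sum>i\<in>?B. (norm (z i))\<^sup>2) \<le> (\<Sum>i\<in>?B. ((4 ^ k + 1) * (\<Sum>j\<in>?B. norm (y j)))\<^sup>2)"
      using norm_hadamard_op_commutator_le[OF y]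
      by (intro sum_mono power_mono) (simp_all add: z_def)
    also have "\<dots> = 4 ^ k * (4 ^ k + 1)\<^sup>2 * (\<Sum>j\<in>?B. norm (y j))\<^sup>2"
      by (simp add: power_mult_distrib)
    also have "\<dots> \<le> 4 ^ k * (4 ^ k + 1)\<^sup>2 * ((\<Sum>j\<in>?B. (norm (y j))\<^sup>2) * 4 ^ k)"
      using sum_squared_le_sum_of_squares[of "\<lambda>j. norm (y j)" ?B]
      by (intro mult_left_mono) auto
    finally show ?thesis by (simp add: power2_eq_square mult_ac)
  qed
  show "z \<in> points ell2" "l2_norm z \<le> (4 ^ k + 1) * 4 ^ k * l2_norm y"
    using l2_le_of_blocks[OF y _ le] by auto
qed

section \<open>Extension of the operator to Z2\<close>

definition hadamard_op_Z2 ::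
    "nat \<Rightarrow> (nat \<Rightarrow> 'a::real_vector) \<times> (nat \<Rightarrow> 'a) \<Rightarrow> (nat \<Rightarrow> 'a) \<times> (nat \<Rightarrow> 'a)" where
  "hadamard_op_Z2 k = map_prod (hadamard_op k) (hadamard_op k)"

lemma hadamard_op_0 [simp]: "hadamard_op k 0 = 0"
  by (simp add: hadamard_op_def fun_eq_iff)

lemma hadamard_op_in_operators:
  "hadamard_op k \<in> operators (ell2 :: ('a::{real_normed_field, real_inner}, nat \<Rightarrow> 'a) qn_space) ell2"
  unfolding operators_def
  by (auto simp: hadamard_op_in_ell2 l2_norm_hadamard_op hadamard_op_add hadamard_op_scale
      intro!: exI[of _ 1] simp del: points_ell2)

lemma hadamard_op_norm_le:
  "op_norm (ell2 :: ('a::{real_normed_field, real_inner}, nat \<Rightarrow> 'a) qn_space) ell2 (hadamard_op k) \<le> 1"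
  unfolding op_norm_def
proof (rule cSUP_least)
  have "0 \<in> {x \<in> points (ell2 :: ('a, nat \<Rightarrow> 'a) qn_space). qnorm ell2 x \<le> 1}"
    by simp
  then show "{x \<in> points (ell2 :: ('a, nat \<Rightarrow> 'a) qn_space). qnorm ell2 x \<le> 1} \<noteq> {}"
    by blast
qed (auto simp: l2_norm_hadamard_op simp del: points_ell2)

text \<open>The quasi-norm sees \<open>x - \<Omega> y\<close>, whose image differs from
  \<open>H x - \<Omega> (H y)\<close> exactly by the commutator of H and \<Omega>.\<close>

lemma hadamard_op_Z2_in_operators:
  "hadamard_op_Z2 k \<in> operators (Z2 :: ('a::{real_normed_field, real_inner}, _) qn_space) Z2"
proof -
  define K :: real where "K = (4 ^ k + 1) * 4 ^ k"
  have *: "hadamard_op_Z2 k (x, y) \<in> points Z2 \<and>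
      qnorm Z2 (hadamard_op_Z2 k (x, y)) \<le> (1 + K) * qnorm Z2 (x, y)"
    if "(x, y) \<in> points Z2" for x y :: "nat \<Rightarrow> 'a"
  proof -
    let ?H = "hadamard_op k :: (nat \<Rightarrow> 'a) \<Rightarrow> nat \<Rightarrow> 'a" and ?\<Omega> = "Kalton_Peck_map :: (nat \<Rightarrow> 'a) \<Rightarrow> nat \<Rightarrow> 'a"
    from that have y: "y \<in> points ell2" and x: "x - ?\<Omega> y \<in> points ell2"
      by (auto simp: points_Z2 simp del: points_ell2)
    have eq: "?H x - ?\<Omega> (?H y) = ?H (x - ?\<Omega> y) + (?H (?\<Omega> y) - ?\<Omega> (?H y))"
      by (simp add: hadamard_op_diff)
    note comm = hadamard_op_commutator_in_ell2[OF y, of k] l2_norm_hadamard_op_commutator_le[OF y, of k]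
    have "?H x - ?\<Omega> (?H y) \<in> points ell2"
      unfolding eq by (intro add_in_ell2 hadamard_op_in_ell2 x comm)
    moreover have "l2_norm (?H x - ?\<Omega> (?H y)) \<le> l2_norm (x - ?\<Omega> y) + K * l2_norm y"
      unfolding eq K_def
      using order_trans[OF l2_norm_triangle[OF hadamard_op_in_ell2[OF x] comm(1)]
          add_mono[OF order_refl comm(2)], of k]
      unfolding l2_norm_hadamard_op[OF x] .
    moreover have "0 \<le> K * l2_norm (x - ?\<Omega> y)"
      using l2_norm_nonneg[OF x] by (simp add: K_def)
    ultimately show ?thesis
      using hadamard_op_in_ell2[OF y] l2_norm_hadamard_op[OF y]
      by (simp add: hadamard_op_Z2_def points_Z2 qnorm_Z2 algebra_simps del: points_ell2)
  qed
  show ?thesis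
    unfolding operators_def
  proof (intro CollectI conjI)
    show "\<exists>C. \<forall>z\<in>points Z2. qnorm Z2 (hadamard_op_Z2 k z) \<le> C * qnorm Z2 (z :: _ \<times> (nat \<Rightarrow> 'a))"
      using * by (intro exI[of _ "1 + K"]) auto
  qed (use * in \<open>auto simp: hadamard_op_Z2_def hadamard_op_add hadamard_op_scale\<close>)
qed

lemma hadamard_op_in_ext:
  "(\<lambda>x. ell2_in_Z2 (hadamard_op k x)) \<in> (ext :: ((nat \<Rightarrow> 'a::{real_normed_field, real_inner}) \<Rightarrow> _) set)"
proof -
  have "hadamard_op_Z2 k \<in> extensions (\<lambda>x::nat \<Rightarrow> 'a. ell2_in_Z2 (hadamard_op k x))"
    using hadamard_op_Z2_in_operators
    by (simp add: extensions_def hadamard_op_Z2_def ell2_in_Z2_def)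
  moreover have "(\<lambda>x::nat \<Rightarrow> 'a. ell2_in_Z2 (hadamard_op k x)) \<in> operators ell2 Z2"
    unfolding operators_def
  proof (intro CollectI conjI)
    show "\<exists>C. \<forall>x\<in>points ell2. qnorm Z2 (ell2_in_Z2 (hadamard_op k x)) \<le> C * qnorm ell2 (x :: nat \<Rightarrow> 'a)"
      by (intro exI[of _ 1]) (auto simp: ell2_in_Z2_isometric l2_norm_hadamard_op simp del: points_ell2)
  qed (use hadamard_op_in_ell2 in \<open>auto simp: ell2_in_Z2_isometric hadamard_op_add hadamard_op_scale
        simp del: points_ell2, auto simp: ell2_in_Z2_def\<close>)
  ultimately show ?thesis by (auto simp: ext_def)
qed

section \<open>Pairing with flat functionals\<close>

text \<open>Against flat coefficients of size \<open>2 ^ - k\<close> on a block of \<open>4 ^ k\<close> coordinates, the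
  Kalton--Peck map acts up to a bounded error as multiplication by \<open>ln (2 ^ k)\<close>.\<close>

definition block_pairing ::
    "nat \<Rightarrow> nat \<Rightarrow> (nat \<Rightarrow> real) \<Rightarrow> (nat \<Rightarrow> 'a::real_vector) \<times> (nat \<Rightarrow> 'a) \<Rightarrow> 'a" where
  "block_pairing k r h z = (\<Sum>l\<in>block k r. h l *\<^sub>R (fst z l - ln (2 ^ k) *\<^sub>R snd z l))"

lemma block_pairing_add:
  "block_pairing k r h (z + w) = block_pairing k r h z + block_pairing k r h w"
  by (simp add: block_pairing_def sum.distrib[symmetric] algebra_simps)

lemma block_pairing_diff:
  "block_pairing k r h (z - w) = block_pairing k r h z - block_pairing k r h w"
  by (simp add: block_pairing_def sum_subtractf[symmetric] algebra_simps)

lemma block_pairing_scale: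
  fixes z :: "(nat \<Rightarrow> 'a::real_normed_field) \<times> (nat \<Rightarrow> 'a)"
  shows "block_pairing k r h (scale Z2 (of_real c) z) = c *\<^sub>R block_pairing k r h z"
  by (cases z) (simp add: block_pairing_def sum_distrib_left scaleR_conv_of_real algebra_simps)

lemma four_power_eq: "(4::real) ^ k = 2 ^ k * 2 ^ k"
  by (simp flip: power_mult_distrib)

text \<open>Let \<open>s\<close> be the ratio of \<open>norm (c l)\<close> to
  \<open>l2_norm c / 2 ^ k\<close>, the modulus of a flat vector of the same norm. The difference is
  \<open>- c l * ln s\<close>, and bounding \<open>s * \<bar>ln s\<bar>\<close> by
  \<open>1 + s^2\<close> gives terms whose sum over a block is at most twice
  \<open>l2_norm c\<close>.\<close>

lemma norm_Kalton_Peck_map_minus_scaled_le: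
  fixes c :: "nat \<Rightarrow> 'a::real_normed_field"
  assumes c: "c \<in> points ell2" and N: "l2_norm c > 0"
  shows "norm (Kalton_Peck_map c l - ln (2 ^ k) *\<^sub>R c l) / 2 ^ k
    \<le> l2_norm c / 4 ^ k + (norm (c l))\<^sup>2 / l2_norm c"
proof (cases "c l = 0")
  case True
  then show ?thesis using N by (simp add: Kalton_Peck_map_def)
next
  case False
  define N where "N = l2_norm c"
  have "N > 0" using assms by (simp add: N_def)
  define s where "s = 2 ^ k * norm (c l) / N"
  have s: "s > 0" using False \<open>N > 0\<close> by (simp add: s_def)
  have "Kalton_Peck_map c l - ln (2 ^ k) *\<^sub>R c l = - (c l * of_real (ln s))"
    using False \<open>N > 0\<close>
    by (simp add: Kalton_Peck_map_def N_def[symmetric] s_def ln_div ln_mult ln_realpow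
        scaleR_conv_of_real algebra_simps)
  then have "norm (Kalton_Peck_map c l - ln (2 ^ k) *\<^sub>R c l) / 2 ^ k = N / 4 ^ k * (s * \<bar>ln s\<bar>)"
    using \<open>N > 0\<close> by (simp add: norm_mult s_def four_power_eq)
  also have "\<dots> \<le> N / 4 ^ k * (1 + s\<^sup>2)"
    using mult_abs_ln_le[OF s] \<open>N > 0\<close> by (intro mult_left_mono) auto
  also have "\<dots> = N / 4 ^ k + (norm (c l))\<^sup>2 / N"
    using \<open>N > 0\<close> by (simp add: s_def four_power_eq field_simps power2_eq_square)
  finally show ?thesis by (simp add: N_def)
qed

text \<open>Write \<open>a - L c\<close> as \<open>(a - \<Omega> c) + (\<Omega> c - L c)\<close>
  with \<open>L = ln (2 ^ k)\<close>. Cauchy-Schwarz handles the first part, since \<open>h\<close>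
  has l2 norm at most 1 on the block; the second part accounts for the constant 2, independent of
  \<open>k\<close>.\<close>

lemma norm_block_pairing_le:
  fixes z :: "(nat \<Rightarrow> 'a::real_normed_field) \<times> (nat \<Rightarrow> 'a)"
  assumes z: "z \<in> points Z2" and h: "\<And>l. \<bar>h l\<bar> \<le> 1 / 2 ^ k"
  shows "norm (block_pairing k r h z) \<le> 2 * qnorm Z2 z"
proof -
  let ?B = "block k r"
  obtain a c where zac: "z = (a, c)" by fastforce
  let ?u = "a - Kalton_Peck_map c"
  let ?w = "\<lambda>l. Kalton_Peck_map c l - ln (2 ^ k) *\<^sub>R c l"
  have c: "c \<in> points ell2" and u: "?u \<in> points ell2"
    using z by (auto simp: zac points_Z2 simp del: points_ell2)
  have "norm (\<Sum>l\<in>?B. h l *\<^sub>R ?u l) \<le> (\<Sum>l\<in>?B. \<bar>h l\<bar> * \<bar>norm (?u l)\<bar>)"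
    by (intro sum_norm_le) simp
  also have "\<dots> \<le> L2_set h ?B * L2_set (\<lambda>l. norm (?u l)) ?B"
    by (rule L2_set_mult_ineq)
  also have "\<dots> \<le> 1 * l2_norm ?u"
  proof (intro mult_mono L2_set_le_l2_norm u)
    have "(\<Sum>l\<in>?B. (h l)\<^sup>2) \<le> (\<Sum>l\<in>?B. (1 / 2 ^ k)\<^sup>2)"
      using h by (intro sum_mono) (metis abs_ge_zero power2_abs power_mono)
    then show "L2_set h ?B \<le> 1"
      by (simp add: L2_set_def four_power_eq power2_eq_square)
  qed auto
  finally have 1: "norm (\<Sum>l\<in>?B. h l *\<^sub>R ?u l) \<le> l2_norm ?u" by simp
  have 2: "norm (\<Sum>l\<in>?B. h l *\<^sub>R ?w l) \<le> 2 * l2_norm c"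
  proof (cases "l2_norm c = 0")
    case True
    then have "c l = 0" for l
      using norm_le_l2_norm[OF c, of l] by simp
    then show ?thesis using True by (simp add: Kalton_Peck_map_def)
  next
    case False
    then have N: "l2_norm c > 0" using l2_norm_nonneg[OF c] by simp
    have "norm (\<Sum>l\<in>?B. h l *\<^sub>R ?w l)
        \<le> (\<Sum>l\<in>?B. l2_norm c / 4 ^ k + (norm (c l))\<^sup>2 / l2_norm c)"
    proof (intro sum_norm_le)
      fix l
      have "norm (h l *\<^sub>R ?w l) \<le> 1 / 2 ^ k * norm (?w l)"
        unfolding norm_scaleR using h by (intro mult_right_mono) auto
      then show "norm (h l *\<^sub>R ?w l) \<le> l2_norm c / 4 ^ k + (norm (c l))\<^sup>2 / l2_norm c"
        using norm_Kalton_Peck_map_minus_scaled_le[OF c N, of l k] by simp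
    qed
    also have "\<dots> = l2_norm c + (L2_set (\<lambda>l. norm (c l)) ?B)\<^sup>2 / l2_norm c"
      by (simp add: sum.distrib sum_divide_distrib L2_set_def sum_nonneg)
    also have "\<dots> \<le> l2_norm c + (l2_norm c)\<^sup>2 / l2_norm c"
      using N c by (intro add_left_mono divide_right_mono power_mono L2_set_le_l2_norm) auto
    finally show ?thesis using N by (simp add: power2_eq_square)
  qed
  have "block_pairing k r h z = (\<Sum>l\<in>?B. h l *\<^sub>R ?u l) + (\<Sum>l\<in>?B. h l *\<^sub>R ?w l)"
    by (simp add: block_pairing_def zac sum.distrib[symmetric] algebra_simps)
  also have "norm \<dots> \<le> l2_norm ?u + 2 * l2_norm c"
    using 1 2 norm_triangle_mono by blast
  also have "\<dots> \<le> 2 * qnorm Z2 z"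
    using l2_norm_nonneg[OF u] by (simp add: zac qnorm_Z2)
  finally show ?thesis .
qed

section \<open>Decay of the pairings as the block moves to infinity\<close>

lemma ell2_tendsto_0:
  fixes x :: "nat \<Rightarrow> 'a::real_normed_field"
  assumes "x \<in> points ell2"
  shows "x \<longlonglongrightarrow> 0"
proof -
  have "(\<lambda>n. sqrt ((norm (x n))\<^sup>2)) \<longlonglongrightarrow> sqrt 0"
    using assms by (intro tendsto_real_sqrt summable_LIMSEQ_zero) simp
  then show ?thesis by (simp add: tendsto_norm_zero_iff)
qed

text \<open>\<Omega> x may leave l2, so the decay is read off the square root bound instead.\<close>

lemma Kalton_Peck_map_tendsto_0:
  fixes x :: "nat \<Rightarrow> 'a::real_normed_field"
  assumes x: "x \<in> points ell2"
  shows "Kalton_Peck_map x \<longlonglongrightarrow> 0"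
proof (rule Lim_null_comparison)
  show "\<forall>\<^sub>F n in sequentially. norm (Kalton_Peck_map x n) \<le> 2 * sqrt (l2_norm x * norm (x n))"
  proof (intro always_eventually allI)
    fix n
    show "norm (Kalton_Peck_map x n) \<le> 2 * sqrt (l2_norm x * norm (x n))"
      using mult_ln_divide_le_sqrt[of "norm (x n)" "l2_norm x"] norm_le_l2_norm[OF x, of n]
        l2_norm_nonneg[OF x]
      by (simp add: Kalton_Peck_map_def norm_mult abs_mult)
  qed
  have "(\<lambda>n. 2 * sqrt (l2_norm x * norm (x n))) \<longlonglongrightarrow> 2 * sqrt (l2_norm x * 0)"
    by (intro tendsto_intros tendsto_norm_zero ell2_tendsto_0 x)
  then show "(\<lambda>n. 2 * sqrt (l2_norm x * norm (x n))) \<longlonglongrightarrow> 0" by simp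
qed

text \<open>Both components of a point of Z2 tend to 0 coordinatewise, and a block has a fixed
  number of coordinates.\<close>

lemma block_pairing_tendsto_0:
  fixes z :: "(nat \<Rightarrow> 'a::real_normed_field) \<times> (nat \<Rightarrow> 'a)"
  assumes z: "z \<in> points Z2" and h: "\<And>r l. \<bar>h r l\<bar> \<le> 1 / 2 ^ k"
  shows "(\<lambda>r. block_pairing k r (h r) z) \<longlonglongrightarrow> 0"
proof -
  obtain a c where zac: "z = (a, c)" by fastforce
  have c: "c \<in> points ell2" and u: "a - Kalton_Peck_map c \<in> points ell2"
    using z by (auto simp: zac points_Z2 simp del: points_ell2)
  let ?w = "\<lambda>l. a l - ln (2 ^ k) *\<^sub>R c l"
  have "(\<lambda>l. (a - Kalton_Peck_map c) l + Kalton_Peck_map c l - ln (2 ^ k) *\<^sub>R c l)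
      \<longlonglongrightarrow> 0 + 0 - ln (2 ^ k) *\<^sub>R 0"
    by (intro tendsto_intros ell2_tendsto_0[OF u] ell2_tendsto_0[OF c] Kalton_Peck_map_tendsto_0[OF c])
  then have w: "?w \<longlonglongrightarrow> 0" by simp
  have "(\<lambda>r. \<Sum>p<4 ^ k. norm (?w (r * 4 ^ k + p))) \<longlonglongrightarrow> (\<Sum>p<(4::nat) ^ k. 0)"
  proof (intro tendsto_sum tendsto_norm_zero filterlim_compose[OF w])
    fix p
    show "filterlim (\<lambda>r. r * 4 ^ k + p) sequentially sequentially"
      by (rule filterlim_at_top_mono[OF filterlim_ident])
         (auto intro!: always_eventually trans_le_add1)
  qed
  then have lim: "(\<lambda>r. \<Sum>p<4 ^ k. norm (?w (r * 4 ^ k + p))) \<longlonglongrightarrow> 0" by simp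
  show ?thesis
  proof (rule Lim_null_comparison[OF _ lim], intro always_eventually allI)
    fix r
    have h1: "\<bar>h r l\<bar> \<le> 1" for l
      using h[of r l] by (rule order_trans) simp
    have "norm (block_pairing k r (h r) z) \<le> (\<Sum>l\<in>block k r. norm (?w l))"
      unfolding block_pairing_def zac fst_conv snd_conv
      using h1 by (intro sum_norm_le) (simp add: mult_left_le_one_le)
    also have "\<dots> = (\<Sum>p<4 ^ k. norm (?w (r * 4 ^ k + p)))"
      unfolding block_def by (subst sum.atLeastLessThan_shift_0) (simp add: atLeast0LessThan)
    finally show "norm (block_pairing k r (h r) z) \<le> (\<Sum>p<4 ^ k. norm (?w (r * 4 ^ k + p)))" .
  qed
qed

text \<open>Along a subsequence staying away from 0, compactness gives a further one with
  \<open>f (v r)\<close> close to a fixed \<open>y\<close>. The pairings are uniformly bounded, so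
  the difference from \<open>y\<close> is negligible, and on \<open>y\<close> itself they tend to
  0.\<close>

lemma compact_block_pairing_tendsto_0:
  fixes f :: "'v::ab_group_add \<Rightarrow> (nat \<Rightarrow> 'a::real_normed_field) \<times> (nat \<Rightarrow> 'a)"
  assumes f: "f \<in> compact_operators X Z2"
    and v: "\<And>r. v r \<in> points X \<and> qnorm X (v r) \<le> 1"
    and h: "\<And>r l. \<bar>h r l\<bar> \<le> 1 / 2 ^ k"
  shows "(\<lambda>r. block_pairing k r (h r) (f (v r))) \<longlonglongrightarrow> 0" (is "?F \<longlonglongrightarrow> 0")
proof (rule ccontr)
  assume "\<not> ?F \<longlonglongrightarrow> 0"
  then obtain e where e: "e > 0" and "\<not> (\<forall>\<^sub>F r in sequentially. norm (?F r) < e)"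
    by (auto simp: tendsto_iff)
  then obtain \<rho> :: "nat \<Rightarrow> nat" where \<rho>: "strict_mono \<rho>" and far: "\<And>n. \<not> norm (?F (\<rho> n)) < e"
    using not_eventually_sequentiallyD by blast
  have fZ: "f x \<in> points Z2" if "x \<in> points X" for x
    using f that by (auto simp: compact_operators_def operators_def)
  obtain \<sigma> y where \<sigma>: "strict_mono \<sigma>" and y: "y \<in> points Z2"
    and lim: "(\<lambda>j. qnorm Z2 (f (v (\<rho> (\<sigma> j))) - y)) \<longlonglongrightarrow> 0"
    using f v unfolding compact_operators_def mem_Collect_eq
    by (elim conjE allE[of _ "\<lambda>j. v (\<rho> j)"]) auto
  let ?\<tau> = "\<lambda>j. \<rho> (\<sigma> j)"
  have \<tau>: "filterlim ?\<tau> sequentially sequentially"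
    using filterlim_compose[OF filterlim_subseq[OF \<rho>] filterlim_subseq[OF \<sigma>]] .
  have "(\<lambda>j. block_pairing k (?\<tau> j) (h (?\<tau> j)) (f (v (?\<tau> j)) - y)) \<longlonglongrightarrow> 0"
  proof (rule Lim_null_comparison)
    show "(\<lambda>j. 2 * qnorm Z2 (f (v (?\<tau> j)) - y)) \<longlonglongrightarrow> 0"
      using tendsto_mult_right_zero[OF lim] .
    show "\<forall>\<^sub>F j in sequentially. norm (block_pairing k (?\<tau> j) (h (?\<tau> j)) (f (v (?\<tau> j)) - y))
        \<le> 2 * qnorm Z2 (f (v (?\<tau> j)) - y)"
      using v y fZ by (intro always_eventually allI norm_block_pairing_le diff_in_Z2 h) auto
  qed
  from tendsto_add[OF this filterlim_compose[OF block_pairing_tendsto_0[where h = h, OF y h] \<tau>]]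
  have "(\<lambda>j. ?F (?\<tau> j)) \<longlonglongrightarrow> 0"
    by (simp add: block_pairing_diff)
  then have "\<forall>\<^sub>F j in sequentially. norm (?F (?\<tau> j)) < e"
    using e by (simp add: tendsto_iff)
  then show False
    using far by (auto simp: eventually_sequentially)
qed

section \<open>Lower bound for the norm of an extension\<close>

lemma qnorm_le_op_norm:
  fixes T :: "'v::ab_group_add \<Rightarrow> 'w::ab_group_add"
  assumes T: "T \<in> operators X Y" and z: "z \<in> points X" "qnorm X z \<le> 1"
    and nonneg: "\<And>z. z \<in> points X \<Longrightarrow> 0 \<le> qnorm X z"
  shows "qnorm Y (T z) \<le> op_norm X Y T"
  unfolding op_norm_def
proof (rule cSUP_upper)
  obtain C where C: "\<And>x. x \<in> points X \<Longrightarrow> qnorm Y (T x) \<le> C * qnorm X x"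
    using T unfolding operators_def by blast
  show "bdd_above ((\<lambda>x. qnorm Y (T x)) ` {x \<in> points X. qnorm X x \<le> 1})"
  proof (rule bdd_aboveI2)
    fix x assume x: "x \<in> {x \<in> points X. qnorm X x \<le> 1}"
    then have "qnorm Y (T x) \<le> C * qnorm X x" by (auto intro: C)
    \<comment> \<open>The bound \<open>C\<close> may be negative, hence the absolute value.\<close>
    also have "\<dots> \<le> \<bar>C\<bar> * 1"
      using x nonneg[of x] by (intro mult_mono) auto
    finally show "qnorm Y (T x) \<le> \<bar>C\<bar>" by simp
  qed
qed (use z in simp)

lemma qnorm_Z2_nonneg: "z \<in> points Z2 \<Longrightarrow> 0 \<le> qnorm Z2 z"
  by (cases z) (simp add: points_Z2 qnorm_Z2 l2_norm_nonneg del: points_ell2)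

lemma finite_support_in_Z2:
  assumes "finite A" "\<And>i. i \<notin> A \<Longrightarrow> x i = 0"
  shows "(0, x) \<in> points Z2"
proof -
  have "0 - Kalton_Peck_map x \<in> points ell2"
    using assms by (intro l2_finite_support(1)[of A]) (auto simp: Kalton_Peck_map_def)
  then show ?thesis
    using l2_finite_support(1)[OF assms] by (simp add: points_Z2 del: points_ell2)
qed

text \<open>With \<open>C\<close> the norm of \<open>T\<close> and \<open>L = ln (2 ^ k)\<close>,
  each of the two families of \<open>4 ^ k\<close> pairings costs \<open>2 * C\<close> per term. Far
  out, the compact part takes at most half of the left side, which doubles 4 to 8.\<close>

lemma op_norm_extension_ge:
  fixes f :: "(nat \<Rightarrow> 'a::{real_normed_field, real_inner}) \<Rightarrow> (nat \<Rightarrow> 'a) \<times> (nat \<Rightarrow> 'a)"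
  assumes f: "f \<in> compact_operators ell2 Z2"
    and T: "T \<in> extensions (\<lambda>x. ell2_in_Z2 (hadamard_op k x) + f x)"
  shows "ln (2 ^ k) \<le> 8 * op_norm Z2 Z2 T"
proof -
  define C where "C = op_norm Z2 Z2 T"
  define L where "L = ln ((2::real) ^ k)"
  define col where "col = (\<lambda>j i. of_real (hadamard k i j) :: 'a)"
  define e where "e = (\<lambda>j i :: nat. of_bool (i = j) :: 'a)"
  let ?row = "\<lambda>j l. hadamard k j l"

  have Top: "T \<in> operators Z2 Z2"
    and Text: "\<And>x. x \<in> points ell2 \<Longrightarrow> T (x, 0) = (hadamard_op k x, 0) + f x"
    using T by (auto simp: extensions_def ell2_in_Z2_def)
  have Tadd: "T (z + w) = T z + T w" if "z \<in> points Z2" "w \<in> points Z2" for z w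
    using Top that by (auto simp: operators_def)
  have Tscale: "T (scale Z2 c z) = scale Z2 c (T z)" if "z \<in> points Z2" for c z
    using Top that by (auto simp: operators_def)
  have TZ: "T z \<in> points Z2" if "z \<in> points Z2" for z
    using Top that by (auto simp: operators_def)
  have h: "\<bar>hadamard k i j\<bar> \<le> 1 / 2 ^ k" for i j
    by (simp add: abs_hadamard)
  have bound: "norm (block_pairing k r g (T z)) \<le> 2 * C"
    if "z \<in> points Z2" "qnorm Z2 z \<le> 1" "\<And>l. \<bar>g l\<bar> \<le> 1 / 2 ^ k" for g r z
  proof -
    have "qnorm Z2 (T z) \<le> C"
      unfolding C_def using that qnorm_Z2_nonneg by (intro qnorm_le_op_norm[OF Top]) auto
    then show ?thesis
      using norm_block_pairing_le[OF TZ, of z g k r] that by simp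
  qed

  have col_ell2: "col j \<in> points ell2" and col_norm: "l2_norm (col j) = 1" for j
  proof -
    have 0: "col j i = 0" if "i \<notin> block k (j div 4 ^ k)" for i
      using that by (simp add: col_def mem_block hadamard_eq_0)
    show "col j \<in> points ell2"
      using finite_block 0 by (rule l2_finite_support(1))
    have "(\<Sum>i\<in>block k (j div 4 ^ k). (hadamard k i j)\<^sup>2) = 1"
      using hadamard_orthogonal_columns[of k j j "j div 4 ^ k"]
      by (simp add: power2_eq_square mem_block)
    then show "l2_norm (col j) = 1"
      using l2_finite_support(2)[OF finite_block 0] by (simp add: L2_set_def col_def)
  qed
  \<comment> \<open>A column is a unit vector of modulus \<open>2 ^ - k\<close> on its support, so
    every logarithm equals \<open>L\<close>.\<close>
  have KP_col: "Kalton_Peck_map (col j) = (\<lambda>i. of_real L * col j i)" for j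
  proof
    fix i
    have "norm (col j i) = 1 / 2 ^ k" if "col j i \<noteq> 0"
      using that abs_hadamard[of k i j] by (auto simp: col_def split: if_splits)
    then show "Kalton_Peck_map (col j) i = of_real L * col j i"
      by (simp add: Kalton_Peck_map_def col_norm L_def)
  qed
  have H_col: "hadamard_op k (col j) = (\<lambda>i. of_real (hadamard k j i))" for j
  proof
    fix i
    have "(\<Sum>l\<in>block k (i div 4 ^ k). hadamard k i l * hadamard k l j) = hadamard k j i"
      by (rule hadamard_square) (simp add: mem_block)
    from arg_cong[where f = "of_real :: real \<Rightarrow> 'a", OF this]
    show "hadamard_op k (col j) i = of_real (hadamard k j i)"
      by (simp add: hadamard_op_def col_def scaleR_conv_of_real)
  qed

  have e_Z2: "(0, e j) \<in> points Z2" for j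
    by (rule finite_support_in_Z2[of "{j}"]) (auto simp: e_def)
  have e_norm: "qnorm Z2 (0, e j) = 1" for j
  proof -
    have "l2_norm (e j) = 1"
      by (subst l2_finite_support(2)[of "{j}"]) (auto simp: e_def)
    moreover from this have "Kalton_Peck_map (e j) = 0"
      by (auto simp: Kalton_Peck_map_def e_def fun_eq_iff)
    ultimately show ?thesis by (simp add: qnorm_Z2)
  qed
  have T_sum: "block_pairing k r g (T (0, \<lambda>i. if i \<in> S then of_real (c i) else 0))
      = (\<Sum>i\<in>S. c i *\<^sub>R block_pairing k r g (T (0, e i)))" if "finite S" for S r g c
    using that
  proof (induction S)
    case empty
    \<comment> \<open>Homogeneity at the scalar 0 supplies \<open>T 0 = 0\<close>.\<close>
    have "T (scale Z2 (of_real 0) 0) = scale Z2 (of_real 0) (T 0)"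
      by (rule Tscale) (simp add: zero_prod_def points_Z2)
    then have "T 0 = 0"
      by (cases "T 0") (simp add: zero_prod_def zero_fun_def)
    then show ?case
      by (simp add: zero_prod_def zero_fun_def block_pairing_def)
  next
    case (insert j S)
    have eq: "(0, \<lambda>i. if i \<in> insert j S then of_real (c i) else 0)
        = (0, \<lambda>i. if i \<in> S then of_real (c i) else 0) + scale Z2 (of_real (c j)) (0, e j)"
      using insert.hyps by (auto simp: e_def fun_eq_iff)
    have "(0, \<lambda>i. if i \<in> S then of_real (c i) else 0 :: 'a) \<in> points Z2"
      by (rule finite_support_in_Z2[OF insert.hyps(1)]) simp
    moreover have "scale Z2 (of_real (c j)) (0, e j) \<in> points Z2"
      using finite_support_in_Z2[of "{j}" "\<lambda>n. of_real (c j) * e j n"] by (simp add: e_def zero_fun_def)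
    ultimately show ?case
      unfolding eq
      by (simp only: Tadd Tscale[OF e_Z2] block_pairing_add block_pairing_scale insert.IH
          sum.insert[OF insert.hyps] add.commute)
  qed
  have T_col: "block_pairing k r g (T (0, col j))
      = (\<Sum>i\<in>block k r. hadamard k i j *\<^sub>R block_pairing k r g (T (0, e i)))"
    if "j \<in> block k r" for j r g
  proof -
    have "col j = (\<lambda>i. if i \<in> block k r then of_real (hadamard k i j) else 0)"
      using that by (auto simp: col_def fun_eq_iff mem_block hadamard_eq_0)
    then show ?thesis using T_sum[of "block k r" r g "\<lambda>i. hadamard k i j"] by simp
  qed

  \<comment> \<open>The first component is \<Omega> of the second, so the quasi-norm is just the l2
    norm of the column.\<close>
  let ?tw = "\<lambda>j. (\<lambda>i. of_real L * col j i, col j)"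
  have tw: "?tw j \<in> points Z2" "qnorm Z2 (?tw j) = 1" for j
    using col_ell2[of j] col_norm[of j]
    by (simp_all add: points_Z2 qnorm_Z2 KP_col[symmetric] del: points_ell2)
       simp
  have T_tw: "block_pairing k r (?row j) (T (?tw j))
      = of_real L + L *\<^sub>R block_pairing k r (?row j) (f (col j)) + block_pairing k r (?row j) (T (0, col j))"
    if j: "j \<in> block k r" for j r
  proof -
    have col0: "(col j, 0) \<in> points Z2"
      using col_ell2[of j] by (simp add: points_Z2 del: points_ell2) simp
    have Lcol0: "scale Z2 (of_real L) (col j, 0) \<in> points Z2"
      using scale_in_ell2[OF col_ell2, of "of_real L" j]
      by (simp add: points_Z2 zero_fun_def[symmetric] del: points_ell2) simp
    have "(0, col j) \<in> points Z2"
      using j by (intro finite_support_in_Z2[of "block k r"]) (auto simp: col_def mem_block hadamard_eq_0)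
    \<comment> \<open>The first summand has norm \<open>L\<close> and lies in l2, where
      \<open>T\<close> is prescribed; this is the source of the large term.\<close>
    moreover have "?tw j = scale Z2 (of_real L) (col j, 0) + (0, col j)"
      by (simp add: fun_eq_iff)
    ultimately have "T (?tw j) = scale Z2 (of_real L) ((hadamard_op k (col j), 0) + f (col j)) + T (0, col j)"
      by (simp only: Tadd[OF Lcol0] Tscale[OF col0] Text[OF col_ell2])
    moreover have "block_pairing k r (?row j) (hadamard_op k (col j), 0) = 1"
    proof -
      have "(\<Sum>l\<in>block k r. hadamard k j l * hadamard k j l) = 1"
        using hadamard_orthogonal_rows[of k j j r] j by simp
      from arg_cong[where f = "of_real :: real \<Rightarrow> 'a", OF this] show ?thesis
        by (simp add: block_pairing_def H_col scaleR_conv_of_real)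
    qed
    ultimately show ?thesis
      by (simp add: block_pairing_add block_pairing_scale scaleR_conv_of_real distrib_left)
  qed

  \<comment> \<open>The exchange of bases rests on the rows of \<open>hadamard k\<close> being the columns of its square.\<close>
  have trace: "(\<Sum>j\<in>block k r. block_pairing k r (?row j) (T (0, col j)))
      = (\<Sum>i\<in>block k r. block_pairing k r (\<lambda>l. hadamard k l i) (T (0, e i)))" for r
  proof -
    let ?B = "block k r"
    define w where "w = (\<lambda>i l. fst (T (0, e i)) l - ln (2 ^ k) *\<^sub>R snd (T (0, e i)) l)"
    have P: "block_pairing k r g (T (0, e i)) = (\<Sum>l\<in>?B. g l *\<^sub>R w i l)" for g i
      by (simp add: block_pairing_def w_def)
    have "(\<Sum>j\<in>?B. block_pairing k r (?row j) (T (0, col j)))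
        = (\<Sum>j\<in>?B. \<Sum>i\<in>?B. \<Sum>l\<in>?B. (hadamard k i j * hadamard k j l) *\<^sub>R w i l)"
      by (simp add: T_col P scaleR_sum_right cong: sum.cong)
    also have "\<dots> = (\<Sum>i\<in>?B. \<Sum>j\<in>?B. \<Sum>l\<in>?B. (hadamard k i j * hadamard k j l) *\<^sub>R w i l)"
      by (rule sum.swap)
    also have "\<dots> = (\<Sum>i\<in>?B. \<Sum>l\<in>?B. (\<Sum>j\<in>?B. hadamard k i j * hadamard k j l) *\<^sub>R w i l)"
      unfolding scaleR_sum_left by (rule sum.cong[OF refl]) (rule sum.swap)
    also have "\<dots> = (\<Sum>i\<in>?B. block_pairing k r (\<lambda>l. hadamard k l i) (T (0, e i)))"
      by (simp add: hadamard_square P)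
    finally show ?thesis .
  qed

  \<comment> \<open>Summing \<open>T_tw\<close> over the block and using \<open>trace\<close> leaves
    only images of unit vectors under \<open>T\<close>, paired with flat functionals, and the
    compact part.\<close>
  have main: "L * 4 ^ k \<le> 4 * C * 4 ^ k
      + L * (\<Sum>j\<in>block k r. norm (block_pairing k r (?row j) (f (col j))))" for r
  proof -
    let ?B = "block k r" and ?P = "\<lambda>j. block_pairing k r (?row j)"
    have "of_real (L * 4 ^ k) = (\<Sum>j\<in>?B. of_real L :: 'a)"
      by simp
    also have "\<dots> = (\<Sum>j\<in>?B. ?P j (T (?tw j)) - L *\<^sub>R ?P j (f (col j)) - ?P j (T (0, col j)))"
      by (intro sum.cong refl) (simp add: T_tw)
    also have "\<dots> = (\<Sum>j\<in>?B. ?P j (T (?tw j))) - (\<Sum>j\<in>?B. L *\<^sub>R ?P j (f (col j)))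
        - (\<Sum>i\<in>?B. block_pairing k r (\<lambda>l. hadamard k l i) (T (0, e i)))"
      by (simp only: sum_subtractf trace)
    finally have eq: "of_real (L * 4 ^ k) = \<dots>" .
    have "norm (a - b - c) \<le> norm a + norm b + norm c" for a b c :: 'a
      using norm_triangle_ineq4[of "a - b" c] norm_triangle_ineq4[of a b] by linarith
    then have "norm (of_real (L * 4 ^ k) :: 'a) \<le> norm (\<Sum>j\<in>?B. ?P j (T (?tw j)))
        + norm (\<Sum>j\<in>?B. L *\<^sub>R ?P j (f (col j)))
        + norm (\<Sum>i\<in>?B. block_pairing k r (\<lambda>l. hadamard k l i) (T (0, e i)))"
      unfolding eq .
    also have "\<dots> \<le> (\<Sum>j\<in>?B. 2 * C) + (\<Sum>j\<in>?B. L * norm (?P j (f (col j)))) + (\<Sum>i\<in>?B. 2 * C)"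
      using tw e_Z2 e_norm h
      by (intro add_mono sum_norm_le bound) (auto simp: L_def)
    finally show ?thesis
      unfolding norm_of_real by (simp add: sum_distrib_left L_def)
  qed

  \<comment> \<open>For each fixed offset \<open>p\<close> the columns form a sequence in the unit
    ball indexed by the block number \<open>r\<close>.\<close>
  have "(\<lambda>r. \<Sum>p<4 ^ k. norm (block_pairing k r (?row (r * 4 ^ k + p)) (f (col (r * 4 ^ k + p)))))
      \<longlonglongrightarrow> (\<Sum>p<(4::nat) ^ k. 0)"
    using col_ell2 col_norm h
    by (intro tendsto_sum tendsto_norm_zero compact_block_pairing_tendsto_0[OF f])
       (simp_all del: points_ell2)
  then have "\<forall>\<^sub>F r in sequentially.
      (\<Sum>p<4 ^ k. norm (block_pairing k r (?row (r * 4 ^ k + p)) (f (col (r * 4 ^ k + p))))) < 4 ^ k / 2"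
    by (rule order_tendstoD) simp
  then obtain r where
    "(\<Sum>p<4 ^ k. norm (block_pairing k r (?row (r * 4 ^ k + p)) (f (col (r * 4 ^ k + p))))) < 4 ^ k / 2"
    by (auto simp: eventually_sequentially)
  then have "(\<Sum>j\<in>block k r. norm (block_pairing k r (?row j) (f (col j)))) < 4 ^ k / 2"
    unfolding block_def by (subst sum.atLeastLessThan_shift_0) (simp add: atLeast0LessThan)
  then have "L * (\<Sum>j\<in>block k r. norm (block_pairing k r (?row j) (f (col j)))) \<le> L * (4 ^ k / 2)"
    by (intro mult_left_mono) (auto simp: L_def)
  with main[of r] have "L * 4 ^ k \<le> 8 * C * 4 ^ k" by linarith
  then show ?thesis by (simp add: L_def C_def)
qed

lemma exists_nat_le_ln_two_power: "\<exists>k. x \<le> ln ((2::real) ^ k)"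
proof -
  obtain k where "x / ln 2 \<le> real k" using real_arch_simple by blast
  then show ?thesis by (intro exI[of _ k]) (simp add: ln_realpow field_simps)
qed

text \<open>The sort covers real and complex scalars at once. Choosing \<open>k\<close> with
  \<open>ln (2 ^ k)\<close> at least \<open>8 * c\<close> absorbs the constant of
  \<open>op_norm_extension_ge\<close>.\<close>

lemma exists_operator_with_large_extensions:
  "\<exists>t \<in> operators (ell2 :: ('a::{real_normed_field, real_inner}, nat \<Rightarrow> 'a) qn_space) ell2.
     (\<lambda>x. ell2_in_Z2 (t x)) \<in> ext \<and>
     op_norm (ell2 :: ('a, nat \<Rightarrow> 'a) qn_space) ell2 t \<le> 1 \<and>
     (\<forall>k \<in> compact_operators ell2 Z2.
        \<forall>T \<in> extensions (\<lambda>x. ell2_in_Z2 (t x) + k x). op_norm Z2 Z2 T \<ge> c)"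
proof -
  obtain k where "8 * c \<le> ln (2 ^ k)"
    using exists_nat_le_ln_two_power by blast
  then show ?thesis
    using op_norm_extension_ge[where ?'a = 'a and k = k]
    by (intro bexI[OF _ hadamard_op_in_operators[of k]] conjI ballI hadamard_op_in_ext hadamard_op_norm_le)
       fastforce
qed

theorem corollary6p27:
  shows "(\<forall>n::nat. \<exists>t \<in> operators (ell2 :: (real, nat \<Rightarrow> real) qn_space) ell2.
            (\<lambda>x. ell2_in_Z2 (t x)) \<in> ext \<and>
            op_norm (ell2 :: (real, nat \<Rightarrow> real) qn_space) ell2 t \<le> 1 \<and>
            (\<forall>k \<in> compact_operators ell2 Z2.
               \<forall>T \<in> extensions (\<lambda>x. ell2_in_Z2 (t x) + k x). op_norm Z2 Z2 T \<ge> real n))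
       \<and> (\<forall>n::nat. \<exists>t \<in> operators (ell2 :: (complex, nat \<Rightarrow> complex) qn_space) ell2.
            (\<lambda>x. ell2_in_Z2 (t x)) \<in> ext \<and>
            op_norm (ell2 :: (complex, nat \<Rightarrow> complex) qn_space) ell2 t \<le> 1 \<and>
            (\<forall>k \<in> compact_operators ell2 Z2.
               \<forall>T \<in> extensions (\<lambda>x. ell2_in_Z2 (t x) + k x). op_norm Z2 Z2 T \<ge> real n))"
  by (intro conjI allI exists_operator_with_large_extensions)

end
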